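(* Let $f:[0,\infty)\to\mathbb{R}$ be a function that is differentiable on $(0,\infty)$, let $0<u<v$, and suppose $f'\in L[u,v]$. Let $q>1$ and let $p$ satisfy $1/p+1/q=1$. If $|f'|^q$ is convex on $[u,v]$, then for each $x\in[u,v]$, $$\left|\frac{(v-x)(vf(v)-uf(x))+(x-u)(vf(x)-uf(u))}{(v-u)^2}-\frac{1}{v-u}\int_u^v f(\mu)\,d\mu\right|$$ $$\le \frac{(v-x)^2}{(v-u)^2}L_p(u,v)\left(\frac{|f'(x)|^q+|f'(v)|^q}{2}\right)^{1/q}+\frac{(x-u)^2}{(v-u)^2}L_p(u,v)\left(\frac{|f'(x)|^q+|f'(u)|^q}{2}\right)^{1/q}.$$
   Context: $L[u,v]$ denotes the space of Lebesgue integrable functions on $[u,v]$. The generalized logarithmic mean is $L_p(u,v)=\left(\frac{v^{p+1}-u^{p+1}}{(p+1)(v-u)}\right)^{1/p}$ for $u\neq v$, $u,v>0$, $p\in\mathbb{R}\setminus\{-1,0\}$. *)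

theory Defs
  imports "HOL-Analysis.Analysis"
begin

(* Only meaningful for u, v > 0, u \<noteq> v and p \<notin> {-1, 0}; elsewhere the value
   is an artefact of division by zero and powr on nonpositive bases. *)
definition gen_log_mean :: "real \<Rightarrow> real \<Rightarrow> real \<Rightarrow> real" where
  "gen_log_mean p u v =
     ((v powr (p + 1) - u powr (p + 1)) / ((p + 1) * (v - u))) powr (1 / p)"

end

theory Submission
  imports Defs
begin

text \<open>
  Fix \<open>x\<close> and cut \<open>[u, v]\<close> at \<open>x\<close>.  On a piece \<open>[a, b]\<close>, \<open>a < b\<close>, let \<open>w\<close> be the affine function with
  \<open>w a = u\<close> and \<open>w b = v\<close>, whose slope is \<open>(v - u) / (b - a)\<close>.  Integrating \<open>(w f)'\<close> gives
  \[ \int_a^b w f' = v f(b) - u f(a) - \frac{v - u}{b - a} \int_a^b f, \]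
  so the left-hand side of the theorem is a combination of the numbers \<open>\<integral> w f'\<close> for the
  pieces \<open>[u, x]\<close> and \<open>[x, v]\<close>.  Each of them is estimated by Hoelder's inequality with
  exponents \<open>p\<close> and \<open>q\<close>.  The mean of \<open>w^p\<close> over \<open>[a, b]\<close> is \<open>L_p(u, v)^p\<close>, because \<open>w\<close> runs
  through \<open>[u, v]\<close> at constant speed whatever the piece is; the mean of \<open>|f'|^q\<close> is at most
  the mean of its endpoint values, because a convex function lies below its chord.
  The identity and the estimate for one piece form \<open>weighted_trapezoid_bound\<close>.

  Hoelder's inequality is used in a form where \<open>|f'|^q\<close> is already replaced by its chord
  (\<open>Hoelder_dominated_integral\<close>).  Every integral that enters it then has an explicit value:
  the fundamental theorem of calculus gives those of \<open>w f'\<close>, \<open>w^p\<close> and the chord.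
\<close>

text \<open>
  Normalise both factors by their norms and integrate Young's inequality
  \<open>x y \<le> x^p / p + y^q / q\<close>.  Young's inequality is pointwise, so \<open>|g|^q\<close> may be replaced
  by a majorant \<open>h\<close> before integrating, and the integral of \<open>h\<close> then takes the place of the
  \<open>q\<close>-norm of \<open>g\<close>.
\<close>

lemma Hoelder_dominated_integral:
  fixes w g h F :: "real \<Rightarrow> real"
  assumes pq: "p > 1" "q > 1" "1 / p + 1 / q = 1"
    and w: "\<And>s. s \<in> S \<Longrightarrow> w s \<ge> 0"
    and F: "(F has_integral J) S" "\<And>s. s \<in> S \<Longrightarrow> \<bar>F s\<bar> \<le> w s * \<bar>g s\<bar>"
    and A: "((\<lambda>s. w s powr p) has_integral A) S"
    and B: "(h has_integral B) S" "\<And>s. s \<in> S \<Longrightarrow> \<bar>g s\<bar> powr q \<le> h s"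
  shows "\<bar>J\<bar> \<le> A powr (1 / p) * B powr (1 / q)"
proof -
  have A0: "A \<ge> 0"
    using A by (rule has_integral_nonneg) simp
  have B0: "B \<ge> 0"
    using B(1) by (rule has_integral_nonneg) (use B(2) powr_ge_zero order_trans in blast)
  \<comment> \<open>The normalisation needs nonzero norms; adding \<open>e\<close> to both integrals covers the
    degenerate cases \<open>A = 0\<close> and \<open>B = 0\<close>, and \<open>e\<close> tends to 0 at the end.\<close>
  have perturbed: "\<bar>J\<bar> \<le> (A + e) powr (1 / p) * (B + e) powr (1 / q)" if "e > 0" for e
  proof -
    define a b where "a = (A + e) powr (1 / p)" and "b = (B + e) powr (1 / q)"
    have ab: "a > 0" "b > 0"
      using A0 B0 that by (auto simp: a_def b_def)
    have ap: "a powr p = A + e" and bq: "b powr q = B + e"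
      using A0 B0 that pq by (auto simp: a_def b_def powr_powr)
    have quotient_le: "X / (r * (X + e)) \<le> 1 / r" if "X \<ge> 0" "r > 0" for X r :: real
    proof -
      have "X / (r * (X + e)) \<le> (X + e) / (r * (X + e))"
        using that \<open>e > 0\<close> by (intro divide_right_mono) auto
      then show ?thesis
        using that \<open>e > 0\<close> by simp
    qed
    define H where "H = (\<lambda>s. a * b * (w s powr p / (p * (A + e)) + h s / (q * (B + e))))"
    have H: "(H has_integral a * b * (A / (p * (A + e)) + B / (q * (B + e)))) S"
      unfolding H_def
      by (intro has_integral_mult_right has_integral_add has_integral_divide A B(1))
    have "\<bar>F s\<bar> \<le> H s" if s: "s \<in> S" for s
    proof -
      have "(w s / a) * (\<bar>g s\<bar> / b) \<le> (w s / a) powr p / p + (\<bar>g s\<bar> / b) powr q / q"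
        using Youngs_inequality[of p q "w s / a" "\<bar>g s\<bar> / b"] pq w[OF s] ab by simp
      also have "\<dots> = w s powr p / (p * (A + e)) + \<bar>g s\<bar> powr q / (q * (B + e))"
        using w[OF s] ab by (simp add: powr_divide ap bq mult.commute)
      also have "\<dots> \<le> w s powr p / (p * (A + e)) + h s / (q * (B + e))"
        using B(2)[OF s] B0 \<open>e > 0\<close> pq by (intro add_left_mono divide_right_mono) auto
      finally have "a * b * ((w s / a) * (\<bar>g s\<bar> / b)) \<le> H s"
        unfolding H_def using ab by (intro mult_left_mono) auto
      then show ?thesis
        using F(2)[OF s] ab by simp
    qed
    then have "\<bar>J\<bar> \<le> a * b * (A / (p * (A + e)) + B / (q * (B + e)))"
      using integral_norm_bound_integral[of F S H] F(1) H
      by (auto simp: has_integral_iff)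
    also have "\<dots> \<le> a * b * (1 / p + 1 / q)"
      using ab pq A0 B0 that by (intro mult_left_mono add_mono quotient_le) auto
    finally show ?thesis
      using pq by (simp add: a_def b_def)
  qed
  have "((\<lambda>e. (A + e) powr (1 / p) * (B + e) powr (1 / q)) \<longlongrightarrow>
      (A + 0) powr (1 / p) * (B + 0) powr (1 / q)) (at_right 0)"
    using A0 B0 pq
    by (intro tendsto_intros tendsto_powr')
       (auto simp: eventually_at_right_less intro!: eventually_mono[OF eventually_at_right_less])
  then show ?thesis
    by (intro tendsto_lowerbound[where F = "at_right 0"])
       (auto intro!: eventually_mono[OF eventually_at_right_less] perturbed)
qed

text \<open>
  The right-hand side is \<open>(b - a) L_p(u, v)^p\<close>: up to the scaling factor this is the
  integral of \<open>t^p\<close> over \<open>[u, v]\<close>, independently of the interval that parametrises it.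
\<close>

lemma has_integral_affine_powr:
  fixes a b u v p :: real
  assumes "a < b" "0 < u" "u < v" "p > 0"
  shows "((\<lambda>s. (u + (v - u) / (b - a) * (s - a)) powr p) has_integral
           (b - a) * ((v powr (p + 1) - u powr (p + 1)) / ((p + 1) * (v - u)))) {a..b}"
proof -
  define k where "k = (v - u) / (b - a)"
  have k: "k > 0" and kba: "k * (b - a) = v - u"
    using assms by (auto simp: k_def)
  define G where "G = (\<lambda>s. (u + k * (s - a)) powr (p + 1) / ((p + 1) * k))"
  have "((\<lambda>s. (u + k * (s - a)) powr p) has_integral G b - G a) {a..b}"
  proof (rule fundamental_theorem_of_calculus)
    fix s assume "s \<in> {a..b}"
    then have "u + k * (s - a) > 0"
      using k \<open>0 < u\<close> by (simp add: add_pos_nonneg)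
    then have "((\<lambda>s. (u + k * (s - a)) powr (p + 1)) has_real_derivative
        (u + k * (s - a)) powr p * ((p + 1) * k)) (at s)"
      by (auto intro!: derivative_eq_intros)
    from DERIV_cdivide[OF this, of "(p + 1) * k"]
    have "(G has_real_derivative (u + k * (s - a)) powr p) (at s)"
      unfolding G_def using k \<open>p > 0\<close> by simp
    then show "(G has_vector_derivative (u + k * (s - a)) powr p) (at s within {a..b})"
      using has_real_derivative_iff_has_vector_derivative has_vector_derivative_at_within by blast
  qed (use assms in simp)
  moreover have "G b - G a = (v powr (p + 1) - u powr (p + 1)) / ((p + 1) * k)"
    using kba by (simp add: G_def diff_divide_distrib)
  moreover have "\<dots> = (b - a) * ((v powr (p + 1) - u powr (p + 1)) / ((p + 1) * (v - u)))"
    unfolding kba[symmetric] using \<open>a < b\<close> by simp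
  ultimately show ?thesis
    by (simp only: k_def)
qed

lemma has_integral_chord:
  fixes a b c d :: real
  assumes "a \<le> b"
  shows "((\<lambda>s. c + (d - c) / (b - a) * (s - a)) has_integral (b - a) * ((c + d) / 2)) {a..b}"
proof -
  define k where "k = (d - c) / (b - a)"
  have "((\<lambda>s. c + k * (s - a)) has_integral
      (c * b + k * (b - a)\<^sup>2 / 2) - (c * a + k * (a - a)\<^sup>2 / 2)) {a..b}"
    by (rule fundamental_theorem_of_calculus)
       (auto intro!: derivative_eq_intros assms
         simp flip: has_real_derivative_iff_has_vector_derivative)
  moreover have "(c * b + k * (b - a)\<^sup>2 / 2) - (c * a + k * (a - a)\<^sup>2 / 2) = (b - a) * ((c + d) / 2)"
  proof (cases "a = b")
    case False
    then have "k * (b - a) = d - c"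
      by (simp add: k_def)
    then have "k * (b - a)\<^sup>2 = (d - c) * (b - a)"
      by (simp add: power2_eq_square flip: mult.assoc)
    then show ?thesis
      by (simp add: field_simps)
  qed simp
  ultimately show ?thesis
    by (simp only: k_def)
qed

text \<open>
  The contribution of one piece, multiplied by \<open>b - a\<close> so that it also makes sense when the
  piece degenerates to a point.  Hoelder's inequality gives the bound
  \<open>((b - a) L_p^p)^(1/p) ((b - a) M)^(1/q)\<close> for the integral of \<open>w f'\<close>, where \<open>M\<close> is the mean
  of the endpoint values; since \<open>1/p + 1/q = 1\<close>, the powers of \<open>b - a\<close> combine to \<open>b - a\<close>.
\<close>

lemma weighted_trapezoid_bound:
  fixes f f' :: "real \<Rightarrow> real" and a b u v p q :: real
  assumes ab: "a \<le> b" and uv: "0 < u" "u < v"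
    and f': "\<And>s. s \<in> {a..b} \<Longrightarrow> (f has_real_derivative f' s) (at s within {a..b})"
    and pq: "p > 1" "q > 1" "1 / p + 1 / q = 1"
    and conv: "convex_on {a..b} (\<lambda>s. \<bar>f' s\<bar> powr q)"
  shows "\<bar>(b - a) * (v * f b - u * f a) - (v - u) * integral {a..b} f\<bar>
    \<le> (b - a)\<^sup>2 * gen_log_mean p u v * ((\<bar>f' a\<bar> powr q + \<bar>f' b\<bar> powr q) / 2) powr (1 / q)"
proof (cases "a = b")
  case False
  with ab have less: "a < b" by simp
  define k where "k = (v - u) / (b - a)"
  have kpos: "k > 0" and kba: "(b - a) * k = v - u" and kba': "k * (b - a) = v - u"
    using uv less by (auto simp: k_def)
  define w where "w s = u + k * (s - a)" for s
  define h where "h s = \<bar>f' a\<bar> powr q + (\<bar>f' b\<bar> powr q - \<bar>f' a\<bar> powr q) / (b - a) * (s - a)" for s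
  define L where "L = (v powr (p + 1) - u powr (p + 1)) / ((p + 1) * (v - u))"
  define M where "M = (\<bar>f' a\<bar> powr q + \<bar>f' b\<bar> powr q) / 2"
  have wpos: "w s > 0" if "s \<in> {a..b}" for s
    using that kpos uv by (simp add: w_def add_pos_nonneg)
  have "continuous_on {a..b} f"
    using f' by (meson DERIV_continuous_on)
  then have intf: "(f has_integral integral {a..b} f) {a..b}"
    by (simp add: integrable_continuous_real integrable_integral)
  have "((\<lambda>s. k * f s + w s * f' s) has_integral w b * f b - w a * f a) {a..b}"
  proof (rule fundamental_theorem_of_calculus[OF ab])
    fix s assume s: "s \<in> {a..b}"
    have "((\<lambda>s. w s * f s) has_real_derivative k * f s + w s * f' s) (at s within {a..b})"
      unfolding w_def by (auto intro!: derivative_eq_intros f'[OF s])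
    then show "((\<lambda>s. w s * f s) has_vector_derivative k * f s + w s * f' s) (at s within {a..b})"
      by (simp add: has_real_derivative_iff_has_vector_derivative)
  qed
  from has_integral_diff[OF this has_integral_mult_right[OF intf, of k]]
  have parts: "((\<lambda>s. w s * f' s) has_integral (v * f b - u * f a) - k * integral {a..b} f) {a..b}"
    using kba' by (simp add: w_def)
  have L0: "L \<ge> 0"
    unfolding L_def using uv pq by (auto intro!: divide_nonneg_pos mult_pos_pos powr_mono2)
  have M0: "M \<ge> 0"
    by (simp add: M_def)
  have "\<bar>(v * f b - u * f a) - k * integral {a..b} f\<bar>
      \<le> ((b - a) * L) powr (1 / p) * ((b - a) * M) powr (1 / q)"
  proof (rule Hoelder_dominated_integral[OF pq _ parts])
    show "((\<lambda>s. w s powr p) has_integral (b - a) * L) {a..b}"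
      using has_integral_affine_powr[OF less uv, of p] pq by (simp add: w_def k_def L_def)
    show "(h has_integral (b - a) * M) {a..b}"
      unfolding h_def M_def by (rule has_integral_chord[OF ab])
    show "\<bar>f' s\<bar> powr q \<le> h s" if "s \<in> {a..b}" for s
      using convex_onD_Icc'[OF conv that] by (simp add: h_def add.commute)
  qed (use wpos in \<open>auto simp: abs_mult less_imp_le\<close>)
  also have "\<dots> = (b - a) powr (1 / p + 1 / q) * (L powr (1 / p) * M powr (1 / q))"
    using less L0 M0 by (simp add: powr_mult powr_add)
  also have "\<dots> = (b - a) * (gen_log_mean p u v * M powr (1 / q))"
    using less pq by (simp add: gen_log_mean_def L_def)
  finally have "(b - a) * \<bar>(v * f b - u * f a) - k * integral {a..b} f\<bar>
      \<le> (b - a) * ((b - a) * (gen_log_mean p u v * M powr (1 / q)))"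
    using less by (intro mult_left_mono) auto
  moreover have "(b - a) * \<bar>(v * f b - u * f a) - k * integral {a..b} f\<bar>
      = \<bar>(b - a) * (v * f b - u * f a) - (b - a) * k * integral {a..b} f\<bar>"
    using less by (simp add: abs_mult_pos' right_diff_distrib mult.assoc)
  ultimately show ?thesis
    unfolding kba by (simp add: M_def power2_eq_square mult.assoc)
qed simp

theorem theorem5:
  fixes f :: "real \<Rightarrow> real" and u v p q :: real
  assumes "f differentiable_on {0<..}"
    and "0 < u" and "u < v"
    and "deriv f absolutely_integrable_on {u..v}"
    and "q > 1" and "1 / p + 1 / q = 1"
    and "convex_on {u..v} (\<lambda>t. \<bar>deriv f t\<bar> powr q)"
  shows "\<forall>x\<in>{u..v}.
    \<bar>((v - x) * (v * f v - u * f x) + (x - u) * (v * f x - u * f u)) / (v - u)\<^sup>2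
        - 1 / (v - u) * integral {u..v} f\<bar>
    \<le> (v - x)\<^sup>2 / (v - u)\<^sup>2 * gen_log_mean p u v
          * ((\<bar>deriv f x\<bar> powr q + \<bar>deriv f v\<bar> powr q) / 2) powr (1 / q)
      + (x - u)\<^sup>2 / (v - u)\<^sup>2 * gen_log_mean p u v
          * ((\<bar>deriv f x\<bar> powr q + \<bar>deriv f u\<bar> powr q) / 2) powr (1 / q)"
proof
  fix x assume x: "x \<in> {u..v}"
  have p: "p > 1"
  proof -
    have "1 / p = 1 - 1 / q"
      using assms(6) by simp
    then have "0 < 1 / p" "1 / p < 1"
      using \<open>q > 1\<close> by auto
    then show ?thesis
      by (simp add: divide_less_eq_1 zero_less_divide_iff)
  qed
  have deriv_f: "(f has_real_derivative deriv f s) (at s within T)" if "s > 0" for s T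
  proof -
    have "f differentiable at s"
      using assms(1) that by (simp add: differentiable_on_eq_differentiable_at)
    then show ?thesis
      using DERIV_deriv_iff_real_differentiable has_field_derivative_at_within by blast
  qed
  define P where "P = (v - x) * (v * f v - u * f x) - (v - u) * integral {x..v} f"
  define Q where "Q = (x - u) * (v * f x - u * f u) - (v - u) * integral {u..x} f"
  define BP where "BP = (v - x)\<^sup>2 * gen_log_mean p u v
          * ((\<bar>deriv f x\<bar> powr q + \<bar>deriv f v\<bar> powr q) / 2) powr (1 / q)"
  define BQ where "BQ = (x - u)\<^sup>2 * gen_log_mean p u v
          * ((\<bar>deriv f x\<bar> powr q + \<bar>deriv f u\<bar> powr q) / 2) powr (1 / q)"
  have "\<bar>P\<bar> \<le> BP"
    unfolding P_def BP_def
    using x assms p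
    by (intro weighted_trapezoid_bound deriv_f convex_on_subset[OF assms(7)]) auto
  moreover have "\<bar>Q\<bar> \<le> BQ"
    unfolding Q_def BQ_def add.commute[of "\<bar>deriv f x\<bar> powr q"]
    using x assms p
    by (intro weighted_trapezoid_bound deriv_f convex_on_subset[OF assms(7)]) auto
  ultimately have "\<bar>P + Q\<bar> / (v - u)\<^sup>2 \<le> (BP + BQ) / (v - u)\<^sup>2"
    by (intro divide_right_mono) auto
  moreover have "((v - x) * (v * f v - u * f x) + (x - u) * (v * f x - u * f u)) / (v - u)\<^sup>2
        - 1 / (v - u) * integral {u..v} f = (P + Q) / (v - u)\<^sup>2"
  proof -
    have "continuous_on {u..v} f"
      using deriv_f \<open>0 < u\<close> by (intro DERIV_continuous_on[of _ _ "deriv f"]) auto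
    then have "integral {u..v} f = integral {u..x} f + integral {x..v} f"
      using x by (intro Henstock_Kurzweil_Integration.integral_combine[symmetric] integrable_continuous_real) auto
    moreover have "1 / (v - u) * I = (v - u) * I / (v - u)\<^sup>2" for I
      using \<open>u < v\<close> by (simp add: power2_eq_square)
    ultimately show ?thesis
      by (simp add: P_def Q_def algebra_simps flip: add_divide_distrib diff_divide_distrib)
  qed
  moreover have "(BP + BQ) / (v - u)\<^sup>2 =
      (v - x)\<^sup>2 / (v - u)\<^sup>2 * gen_log_mean p u v
          * ((\<bar>deriv f x\<bar> powr q + \<bar>deriv f v\<bar> powr q) / 2) powr (1 / q)
      + (x - u)\<^sup>2 / (v - u)\<^sup>2 * gen_log_mean p u v
          * ((\<bar>deriv f x\<bar> powr q + \<bar>deriv f u\<bar> powr q) / 2) powr (1 / q)"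
    unfolding BP_def BQ_def add_divide_distrib by (simp only: times_divide_eq_left)
  moreover have "\<bar>(P + Q) / (v - u)\<^sup>2\<bar> = \<bar>P + Q\<bar> / (v - u)\<^sup>2"
    by simp
  ultimately show "\<bar>((v - x) * (v * f v - u * f x) + (x - u) * (v * f x - u * f u)) / (v - u)\<^sup>2
        - 1 / (v - u) * integral {u..v} f\<bar>
    \<le> (v - x)\<^sup>2 / (v - u)\<^sup>2 * gen_log_mean p u v
          * ((\<bar>deriv f x\<bar> powr q + \<bar>deriv f v\<bar> powr q) / 2) powr (1 / q)
      + (x - u)\<^sup>2 / (v - u)\<^sup>2 * gen_log_mean p u v
          * ((\<bar>deriv f x\<bar> powr q + \<bar>deriv f u\<bar> powr q) / 2) powr (1 / q)"
    by (simp only:)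
qed

end
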